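(* Let $A\in\mathbb{R}^{n\times n}$, $\mathbf{v},\mathbf{w}\in\mathbb{R}^n$, and $\hat A=A+\mathbf{v}\mathbf{w}^T$, and suppose that all leading principal minors of $A$ and of $\hat A$ are nonzero (in particular both matrices are nonsingular). Let $LD^{-1}U$ and $\hat L\hat D^{-1}\hat U$ be the REF-LU factorizations of $A$ and $\hat A$, respectively. Then the result of applying forward substitution on $\mathbf{v}$ using $L$ matches the result of applying forward substitution on $\mathbf{v}$ using $\hat L$, that is, $$(LD^{-1})^{-1}\mathbf{v}=(\hat L\hat D^{-1})^{-1}\mathbf{v}.$$
   Context: Let $M\in\mathbb{R}^{n\times n}$ have all leading principal minors nonzero. Integer-preserving Gaussian elimination (IPGE) on $M$ (no permutations): $m^{(0)}_{i,j}=m_{i,j}$, $\rho^{(0)}=1$, and for $k=1,\dots,n$, with pivot $\rho^{(k)}=m^{(k-1)}_{k,k}$, set, for $k\le i,j\le n$, $m^{(k)}_{i,j}=m^{(k-1)}_{i,j}$ if $i=k$, and $m^{(k)}_{i,j}=\bigl(\rho^{(k)}m^{(k-1)}_{i,j}-m^{(k-1)}_{k,j}m^{(k-1)}_{i,k}\bigr)/\rho^{(k-1)}$ otherwise. (The pivot $\rho^{(k)}$ equals the $k$th leading principal minor of $M$, hence is nonzero.) The REF-LU factorization of $M$ is the triple $L,D,U$ where $L$ is lower triangular with $l_{i,j}=m^{(j-1)}_{i,j}$ for $i\ge j$, $D$ is diagonal with $d_{i,i}=\rho^{(i-1)}\rho^{(i)}$, and $U$ is upper triangular with $u_{i,j}=m^{(i-1)}_{i,j}$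 for $i\le j$; it satisfies $M=LD^{-1}U$ and $l_{i,i}=u_{i,i}=\rho^{(i)}$. The result of (REF) forward substitution on a vector $\mathbf{b}$ using $L$ is the vector $\mathbf{y}$ solving $LD^{-1}\mathbf{y}=\mathbf{b}$. *)

theory Defs
  imports
    "Jordan_Normal_Form.Determinant"
    "Jordan_Normal_Form.Gauss_Jordan_Elimination"
    "Jordan_Normal_Form.DL_Submatrix"
begin

definition leading_minor :: "real mat \<Rightarrow> nat \<Rightarrow> real" where
  "leading_minor M k = det (submatrix M {..<k} {..<k})"

text \<open>
  Rows and columns are indexed from 0, as usual for \<^typ>\<open>real mat\<close>, whereas the elimination
  steps are counted from 1. Hence step \<open>k + 1\<close> uses row and column \<open>k\<close>, and the entry usually
  written \<open>m\<close> with superscript \<open>k\<close> and subscript \<open>i, j\<close> is \<open>ipge M k (i - 1) (j - 1)\<close>. It is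
  meaningful only if \<open>k \<le> i\<close> and \<open>k \<le> j\<close>; values outside this range are never used below.
\<close>

function ipge :: "real mat \<Rightarrow> nat \<Rightarrow> nat \<Rightarrow> nat \<Rightarrow> real"
  and pivot :: "real mat \<Rightarrow> nat \<Rightarrow> real" where
  "ipge M 0 i j = M $$ (i, j)"
| "ipge M (Suc k) i j =
    (if i = k then ipge M k i j
     else (pivot M (Suc k) * ipge M k i j - ipge M k k j * ipge M k i k) / pivot M k)"
| "pivot M 0 = 1"
| "pivot M (Suc k) = ipge M k k k"
  by pat_completeness auto
termination
  by (relation "measure (case_sum (\<lambda>(M, k, i, j). 2 * k) (\<lambda>(M, k). 2 * k - 1))") auto

definition ref_L :: "real mat \<Rightarrow> real mat" where
  "ref_L M = mat (dim_row M) (dim_row M) (\<lambda>(i, j). if j \<le> i then ipge M j i j else 0)"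

definition ref_D :: "real mat \<Rightarrow> real mat" where
  "ref_D M = mat_diag (dim_row M) (\<lambda>i. pivot M i * pivot M (Suc i))"

definition ref_U :: "real mat \<Rightarrow> real mat" where
  "ref_U M = mat (dim_row M) (dim_row M) (\<lambda>(i, j). if i \<le> j then ipge M i i j else 0)"

definition ref_lu :: "real mat \<Rightarrow> real mat \<times> real mat \<times> real mat" where
  "ref_lu M = (ref_L M, ref_D M, ref_U M)"

definition mat_inv :: "real mat \<Rightarrow> real mat" where
  "mat_inv X = the (mat_inverse X)"

definition forward_subst :: "real mat \<Rightarrow> real mat \<Rightarrow> real vec \<Rightarrow> real vec" where
  "forward_subst L D b =
    (THE y. y \<in> carrier_vec (dim_row L) \<and> (L * mat_inv D) *\<^sub>v y = b)"

definition outer_prod :: "real vec \<Rightarrow> real vec \<Rightarrow> real mat" where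
  "outer_prod v w = mat (dim_vec v) (dim_vec w) (\<lambda>(i, j). v $ i * w $ j)"

text \<open>
  The remaining facts show that, if the leading principal minors are nonzero, every inverse and
  every definite description involved is well defined, and that the factorization is correct.
\<close>

lemma mat_inv:
  assumes "X \<in> carrier_mat n n" "det X \<noteq> 0"
  shows "mat_inv X \<in> carrier_mat n n" "X * mat_inv X = 1\<^sub>m n" "mat_inv X * X = 1\<^sub>m n"
proof -
  have "mat_inverse X \<noteq> None"
    using mat_inverse(1)[OF assms(1), where b = "()"] det_non_zero_imp_unit[OF assms, where b = "()"]
    by blast
  then obtain B where "mat_inverse X = Some B" by blast
  with mat_inverse(2)[OF assms(1) this]
  show "mat_inv X \<in> carrier_mat n n" "X * mat_inv X = 1\<^sub>m n" "mat_inv X * X = 1\<^sub>m n"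
    by (auto simp: mat_inv_def)
qed

lemma leading_minor_eq:
  assumes "M \<in> carrier_mat n n" "k \<le> n"
  shows "leading_minor M k = det (mat k k (\<lambda>(i, j). M $$ (i, j)))"
proof -
  have pick: "pick {..<k} i = i" if "i < k" for i
  proof -
    have "{a \<in> {..<k}. a < i} = {..<i}" using that by auto
    then show ?thesis using pick_card_in_set[of i "{..<k}"] that by simp
  qed
  have "{i. i < n \<and> i \<in> {..<k}} = {..<k}" using assms(2) by auto
  then have "card {i. i < n \<and> i \<in> {..<k}} = k" by (simp only: card_lessThan)
  then have "submatrix M {..<k} {..<k} = mat k k (\<lambda>(i, j). M $$ (pick {..<k} i, pick {..<k} j))"
    unfolding submatrix_def carrier_matD[OF assms(1)] by (simp only:)
  also have "\<dots> = mat k k (\<lambda>(i, j). M $$ (i, j))"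
    by (rule eq_matI) (simp_all add: pick)
  finally have "submatrix M {..<k} {..<k} = mat k k (\<lambda>(i, j). M $$ (i, j))" .
  then show ?thesis by (simp add: leading_minor_def)
qed

lemma ipge_expansion:
  assumes "t \<le> i" "t \<le> j" "\<And>s. s \<le> t \<Longrightarrow> pivot M s \<noteq> 0"
  shows "M $$ (i, j) =
    (\<Sum>s<t. ipge M s i s * ipge M s s j / (pivot M s * pivot M (Suc s))) + ipge M t i j / pivot M t"
  using assms
proof (induction t)
  case 0
  then show ?case by simp
next
  case (Suc t)
  have nz: "pivot M t \<noteq> 0" "pivot M (Suc t) \<noteq> 0" using Suc.prems(3) le_Suc_eq by blast+
  have "i \<noteq> t" using Suc.prems by simp
  then have "ipge M (Suc t) i j =
      (pivot M (Suc t) * ipge M t i j - ipge M t t j * ipge M t i t) / pivot M t"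
    by (simp del: pivot.simps)
  then have "ipge M t i j / pivot M t =
      ipge M t i t * ipge M t t j / (pivot M t * pivot M (Suc t)) +
      ipge M (Suc t) i j / pivot M (Suc t)"
    using nz by (simp add: field_simps del: pivot.simps ipge.simps)
  moreover have "M $$ (i, j) =
    (\<Sum>s<t. ipge M s i s * ipge M s s j / (pivot M s * pivot M (Suc s))) + ipge M t i j / pivot M t"
    using Suc by simp
  ultimately show ?case by (simp del: pivot.simps ipge.simps)
qed

lemma pivot_nonzero:
  assumes M: "M \<in> carrier_mat n n" and nz: "\<forall>k\<in>{1..n}. leading_minor M k \<noteq> 0" and "k \<le> n"
  shows "pivot M k \<noteq> 0"
  using \<open>k \<le> n\<close>
proof (induction k rule: less_induct)
  case (less k)
  show ?case
  proof (cases k)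
    case 0
    then show ?thesis by simp
  next
    case (Suc k')
    have IH: "pivot M s \<noteq> 0" if "s < k" for s using less that by simp
    define W where "W = mat k k (\<lambda>(i, j).
      if i = j then 1 else if j < i then ipge M j i j / pivot M (Suc j) else 0)"
    define V where "V = mat k k (\<lambda>(i, j). if i \<le> j then ipge M i i j / pivot M i else 0)"
    have W: "W \<in> carrier_mat k k" and V: "V \<in> carrier_mat k k" by (auto simp: W_def V_def)
    have entry: "M $$ (i, j) = (\<Sum>s<k. W $$ (i, s) * V $$ (s, j))" if ij: "i < k" "j < k" for i j
    proof -
      define t where "t = min i j"
      have t: "t \<le> i" "t \<le> j" "t < k" using ij by (auto simp: t_def)
      have "(\<Sum>s<k. W $$ (i, s) * V $$ (s, j)) = (\<Sum>s\<in>{..<t} \<union> {t}. W $$ (i, s) * V $$ (s, j))"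
        using ij t by (intro sum.mono_neutral_right) (auto simp: W_def V_def t_def)
      also have "\<dots> = (\<Sum>s<t. W $$ (i, s) * V $$ (s, j)) + W $$ (i, t) * V $$ (t, j)"
        by (subst sum.union_disjoint) auto
      also have "(\<Sum>s<t. W $$ (i, s) * V $$ (s, j)) =
          (\<Sum>s<t. ipge M s i s * ipge M s s j / (pivot M s * pivot M (Suc s)))"
        using ij t by (intro sum.cong) (auto simp: W_def V_def)
      also have "W $$ (i, t) * V $$ (t, j) = ipge M t i j / pivot M t"
      proof (cases "i \<le> j")
        case True
        then show ?thesis using ij by (simp add: W_def V_def t_def)
      next
        case False
        then have "t = j" "j < i" "pivot M (Suc j) \<noteq> 0" using IH[of "Suc j"] ij by (auto simp: t_def)
        then show ?thesis using ij by (simp add: W_def V_def)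
      qed
      finally show ?thesis using ipge_expansion[of t i j M] t IH by simp
    qed
    have "mat k k (\<lambda>(i, j). M $$ (i, j)) = W * V"
      using W V by (intro eq_matI) (auto simp: scalar_prod_def entry atLeast0LessThan)
    then have "leading_minor M k = det W * det V"
      using leading_minor_eq[OF M less.prems] det_mult[OF W V] by simp
    then have "det V \<noteq> 0" using nz less.prems Suc by auto
    moreover have "det V = prod_list (diag_mat V)"
      by (rule det_upper_triangular[OF _ V]) (auto simp: V_def upper_triangular_def)
    ultimately have "0 \<notin> set (diag_mat V)" by (simp add: prod_list_zero_iff)
    moreover have "V $$ (k', k') \<in> set (diag_mat V)"
      using V Suc by (auto simp: diag_mat_def)
    ultimately have "V $$ (k', k') \<noteq> 0" by metis
    then show ?thesis using Suc by (auto simp: V_def)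
  qed
qed

lemma ref_lu_carrier:
  assumes "M \<in> carrier_mat n n"
  shows "ref_L M \<in> carrier_mat n n" "ref_D M \<in> carrier_mat n n" "ref_U M \<in> carrier_mat n n"
  using assms by (auto simp: ref_L_def ref_D_def ref_U_def mat_diag_def)

context
  fixes M :: "real mat" and n :: nat
  assumes M: "M \<in> carrier_mat n n" and nz: "\<forall>k\<in>{1..n}. leading_minor M k \<noteq> 0"
begin

lemma det_ref_D_nonzero: "det (ref_D M) \<noteq> 0"
proof -
  have "det (ref_D M) = prod_list (diag_mat (ref_D M))"
    by (rule det_upper_triangular[OF _ ref_lu_carrier(2)[OF M]])
      (auto simp: ref_D_def mat_diag_def upper_triangular_def)
  also have "\<dots> \<noteq> 0"
    using M pivot_nonzero[OF M nz]
    by (auto simp: prod_list_zero_iff diag_mat_def ref_D_def mat_diag_def simp del: pivot.simps)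
  finally show ?thesis .
qed

lemma det_ref_L_nonzero: "det (ref_L M) \<noteq> 0"
proof -
  have "det (ref_L M) = prod_list (diag_mat (ref_L M))"
    by (rule det_lower_triangular[OF _ ref_lu_carrier(1)[OF M]]) (use M in \<open>auto simp: ref_L_def\<close>)
  also have "\<dots> \<noteq> 0"
    using M pivot_nonzero[OF M nz, of "Suc i" for i]
    by (auto simp: prod_list_zero_iff diag_mat_def ref_L_def Suc_le_eq)
  finally show ?thesis .
qed

lemma mat_inv_ref_D:
  "mat_inv (ref_D M) = mat_diag n (\<lambda>i. 1 / (pivot M i * pivot M (Suc i)))" (is "_ = ?E")
proof -
  note D = ref_lu_carrier(2)[OF M]
  note I = mat_inv[OF D det_ref_D_nonzero]
  have E: "?E \<in> carrier_mat n n" by (simp add: mat_diag_def)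
  have "ref_D M * ?E =
      mat_diag n (\<lambda>i. pivot M i * pivot M (Suc i) * (1 / (pivot M i * pivot M (Suc i))))"
    unfolding ref_D_def carrier_matD(1)[OF M] mat_diag_diag ..
  also have "\<dots> = 1\<^sub>m n"
    using pivot_nonzero[OF M nz] by (auto simp: mat_diag_def simp del: pivot.simps)
  finally have "ref_D M * ?E = 1\<^sub>m n" .
  then have "mat_inv (ref_D M) * (ref_D M * ?E) = mat_inv (ref_D M)" using I by simp
  then show ?thesis
    using I(3) left_mult_one_mat[OF E] assoc_mult_mat[OF I(1) D E] by simp
qed

lemma det_ref_LD_nonzero: "det (ref_L M * mat_inv (ref_D M)) \<noteq> 0"
proof -
  note D = ref_lu_carrier(2)[OF M]
  note I = mat_inv[OF D det_ref_D_nonzero]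
  have "det (ref_D M) * det (mat_inv (ref_D M)) = 1"
    using I(2) det_mult[OF D I(1)] by simp
  then show ?thesis
    using det_ref_L_nonzero det_mult[OF ref_lu_carrier(1)[OF M] I(1)] by auto
qed

lemma ref_lu_correct: "M = ref_L M * mat_inv (ref_D M) * ref_U M"
proof (rule eq_matI)
  fix i j
  assume "i < dim_row (ref_L M * mat_inv (ref_D M) * ref_U M)"
    and "j < dim_col (ref_L M * mat_inv (ref_D M) * ref_U M)"
  then have ij: "i < n" "j < n" using M by (auto simp: ref_L_def ref_U_def)
  define t where "t = min i j"
  have t: "t \<le> i" "t \<le> j" "t < n" using ij by (auto simp: t_def)
  note piv = pivot_nonzero[OF M nz]
  let ?f = "\<lambda>s. ref_L M $$ (i, s) / (pivot M s * pivot M (Suc s)) * ref_U M $$ (s, j)"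
  define X where "X = ref_L M * mat_inv (ref_D M)"
  have X: "X \<in> carrier_mat n n"
    using ref_lu_carrier[OF M] mat_inv(1)[OF _ det_ref_D_nonzero] by (auto simp: X_def)
  have "X $$ (i, s) = ref_L M $$ (i, s) / (pivot M s * pivot M (Suc s))" if "s < n" for s
    using that ij mat_diag_mult_right[OF ref_lu_carrier(1)[OF M]]
    by (simp add: X_def mat_inv_ref_D del: pivot.simps)
  then have "(X * ref_U M) $$ (i, j) = (\<Sum>s<n. ?f s)"
    using ij X ref_lu_carrier(3)[OF M] by (simp add: scalar_prod_def atLeast0LessThan)
  also have "\<dots> = (\<Sum>s\<in>{..<t} \<union> {t}. ?f s)"
    using ij t M by (intro sum.mono_neutral_right) (auto simp: ref_L_def ref_U_def t_def)
  also have "\<dots> = (\<Sum>s<t. ?f s) + ?f t"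
    by (subst sum.union_disjoint) auto
  also have "(\<Sum>s<t. ?f s) =
      (\<Sum>s<t. ipge M s i s * ipge M s s j / (pivot M s * pivot M (Suc s)))"
    using ij t M by (intro sum.cong) (auto simp: ref_L_def ref_U_def)
  also have "?f t = ipge M t i j / pivot M t"
    using ij t M piv[of "Suc t"] by (cases "i \<le> j") (auto simp: ref_L_def ref_U_def t_def)
  finally show "M $$ (i, j) = (ref_L M * mat_inv (ref_D M) * ref_U M) $$ (i, j)"
    using ipge_expansion[of t i j M] t piv by (simp add: X_def)
qed (use M in \<open>auto simp: ref_L_def ref_U_def\<close>)

lemma forward_subst_eq:
  assumes b: "b \<in> carrier_vec n"
  shows "\<exists>!y. y \<in> carrier_vec n \<and> (ref_L M * mat_inv (ref_D M)) *\<^sub>v y = b"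
    and "forward_subst (ref_L M) (ref_D M) b = mat_inv (ref_L M * mat_inv (ref_D M)) *\<^sub>v b"
proof -
  define X where "X = ref_L M * mat_inv (ref_D M)"
  have X: "X \<in> carrier_mat n n"
    using ref_lu_carrier[OF M] mat_inv(1)[OF _ det_ref_D_nonzero] by (auto simp: X_def)
  note I = mat_inv[OF X det_ref_LD_nonzero[folded X_def]]
  have sol: "mat_inv X *\<^sub>v b \<in> carrier_vec n \<and> X *\<^sub>v (mat_inv X *\<^sub>v b) = b"
    using I X b by (simp flip: assoc_mult_mat_vec)
  have uniq: "y = mat_inv X *\<^sub>v b" if "y \<in> carrier_vec n \<and> X *\<^sub>v y = b" for y
  proof -
    have "mat_inv X *\<^sub>v (X *\<^sub>v y) = y"
      using that I(3) assoc_mult_mat_vec[OF I(1) X, of y] by simp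
    then show ?thesis using that by simp
  qed
  show "\<exists>!y. y \<in> carrier_vec n \<and> (ref_L M * mat_inv (ref_D M)) *\<^sub>v y = b"
    using sol uniq unfolding X_def by blast
  have "dim_row (ref_L M) = n" using M by (simp add: ref_L_def)
  then show "forward_subst (ref_L M) (ref_D M) b = mat_inv (ref_L M * mat_inv (ref_D M)) *\<^sub>v b"
    using the_equality[of "\<lambda>y. y \<in> carrier_vec n \<and> X *\<^sub>v y = b", OF sol uniq]
    by (simp add: forward_subst_def X_def)
qed

end

end

theory Submission
  imports Defs
begin

text \<open>
  By Cramer's rule, the \<open>k\<close>-th entry of the result of forward substitution on \<open>v\<close> is the
  \<open>k\<close>-th leading principal minor of the matrix obtained from \<open>M\<close> by putting \<open>v\<close> in column \<open>k\<close>: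
  the pivots telescope, so that no denominator is left. Adding \<open>v w\<^sup>T\<close> to \<open>M\<close> adds multiples of
  this column \<open>v\<close> to the preceding ones and therefore leaves the minor unchanged.
\<close>

definition bordered :: "real mat \<Rightarrow> real vec \<Rightarrow> nat \<Rightarrow> real mat" where
  "bordered M v m = mat (Suc m) (Suc m) (\<lambda>(i, j). if j = m then v $ i else M $$ (i, j))"

lemma bordered_carrier [simp]: "bordered M v m \<in> carrier_mat (Suc m) (Suc m)"
  by (simp add: bordered_def)

lemma det_bordered_add_outer_prod:
  assumes M: "M \<in> carrier_mat n n" and v: "v \<in> carrier_vec n" and w: "w \<in> carrier_vec n"
    and m: "m < n"
  shows "det (bordered (M + outer_prod v w) v m) = det (bordered M v m)"
proof -
  \<comment> \<open>\<open>C\<close> encodes the column operations: right multiplication by it adds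
    \<open>w $ j\<close> times the last column to each column \<open>j < m\<close>. It is unit lower
    triangular, so its determinant is 1.\<close>
  define C :: "real mat" where "C = mat (Suc m) (Suc m)
    (\<lambda>(i, j). (if i = j then 1 else 0) + (if i = m \<and> j < m then w $ j else 0))"
  have C: "C \<in> carrier_mat (Suc m) (Suc m)" by (simp add: C_def)
  have "bordered (M + outer_prod v w) v m = bordered M v m * C"
  proof (rule eq_matI)
    fix i j
    assume "i < dim_row (bordered M v m * C)" "j < dim_col (bordered M v m * C)"
    then have ij: "i < Suc m" "j < Suc m" by (simp_all add: bordered_def C_def)
    have "(bordered M v m * C) $$ (i, j) =
        (\<Sum>s<Suc m. bordered M v m $$ (i, s) * C $$ (s, j))"
      using ij by (simp add: scalar_prod_def atLeast0LessThan bordered_def C_def)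
    \<comment> \<open>The term \<open>s = m\<close> meets the bordering column \<open>v\<close>, so
      the last row of \<open>C\<close> contributes exactly the entry of
      \<open>outer_prod v w\<close>.\<close>
    also have "\<dots> = (\<Sum>s<Suc m. (if s = j then bordered M v m $$ (i, s) else 0) +
        (if s = m then (if j < m then v $ i * w $ j else 0) else 0))"
      using ij by (intro sum.cong) (auto simp: C_def bordered_def algebra_simps)
    also have "\<dots> = bordered M v m $$ (i, j) + (if j < m then v $ i * w $ j else 0)"
      unfolding sum.distrib using ij by (simp add: sum.delta del: sum.lessThan_Suc)
    also have "\<dots> = bordered (M + outer_prod v w) v m $$ (i, j)"
      using ij m M v w by (auto simp: bordered_def outer_prod_def)
    finally show "bordered (M + outer_prod v w) v m $$ (i, j) = (bordered M v m * C) $$ (i, j)"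
      by simp
  qed (simp_all add: bordered_def C_def)
  moreover have "det C = 1"
  proof -
    have "det C = prod_list (diag_mat C)"
      by (rule det_lower_triangular[OF _ C]) (auto simp: C_def)
    also have "\<dots> = (\<Prod>i<Suc m. C $$ (i, i))"
      using C by (simp add: prod_list_diag_prod atLeast0LessThan del: prod.lessThan_Suc)
    also have "\<dots> = 1" by (rule prod.neutral) (auto simp: C_def)
    finally show ?thesis .
  qed
  ultimately show ?thesis using det_mult[OF bordered_carrier C] by simp
qed

text \<open>The equations \<open>M = X U\<close> and \<open>X y = v\<close>, with \<open>X\<close>
  lower triangular, restrict to the leading blocks and combine into one triangular factorization of
  \<open>bordered M v m\<close>. Taking determinants isolates \<open>y $ m\<close>. As
  \<open>m\<close> counts from 0, it stands for \<open>k = m + 1\<close> in the overview.\<close>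

lemma solution_eq_det_bordered:
  assumes M: "M \<in> carrier_mat n n" and nz: "\<forall>k\<in>{1..n}. leading_minor M k \<noteq> 0"
    and y: "y \<in> carrier_vec n" and sol: "(ref_L M * mat_inv (ref_D M)) *\<^sub>v y = v"
    and m: "m < n"
  shows "y $ m = det (bordered M v m)"
proof -
  note piv = pivot_nonzero[OF M nz]
  define X where "X = ref_L M * mat_inv (ref_D M)"
  have X: "X \<in> carrier_mat n n"
    using ref_lu_carrier[OF M] mat_inv(1)[OF _ det_ref_D_nonzero[OF M nz]] by (auto simp: X_def)
  have X_index: "X $$ (i, s) = (if s \<le> i then ipge M s i s else 0) / (pivot M s * pivot M (Suc s))"
    if "i < n" "s < n" for i s
    using that M mat_diag_mult_right[OF ref_lu_carrier(1)[OF M]]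
    by (simp add: X_def mat_inv_ref_D[OF M nz] ref_L_def del: pivot.simps)
  note U = ref_lu_carrier(3)[OF M]
  define W where "W = mat (Suc m) (Suc m) (\<lambda>(i, j). X $$ (i, j))"
  \<comment> \<open>Replacing the last column of the leading block of \<open>ref_U M\<close> by
    \<open>y\<close> keeps it upper triangular and puts \<open>y $ m\<close> in the corner.\<close>
  define V where "V = bordered (ref_U M) y m"
  have W: "W \<in> carrier_mat (Suc m) (Suc m)" by (simp add: W_def)
  have V: "V \<in> carrier_mat (Suc m) (Suc m)" by (simp add: V_def)
  \<comment> \<open>Rows up to \<open>m\<close> of \<open>X\<close> vanish beyond column
    \<open>m\<close>, so products of the leading blocks agree with those of the full
    matrices.\<close>
  have truncate: "(\<Sum>s<n. X $$ (i, s) * f s) = (\<Sum>s<Suc m. X $$ (i, s) * f s)"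
    if "i < Suc m" for i and f :: "nat \<Rightarrow> real"
    using that m by (intro sum.mono_neutral_right) (auto simp: X_index)
  have "bordered M v m = W * V"
  proof (rule eq_matI)
    fix i j
    assume "i < dim_row (W * V)" "j < dim_col (W * V)"
    then have ij: "i < Suc m" "j < Suc m" using W V by simp_all
    have "(W * V) $$ (i, j) = (\<Sum>s<Suc m. X $$ (i, s) * V $$ (s, j))"
      using ij V by (simp add: scalar_prod_def atLeast0LessThan W_def del: sum.lessThan_Suc)
    also have "\<dots> = (\<Sum>s<Suc m. X $$ (i, s) * (if j = m then y $ s else ref_U M $$ (s, j)))"
      using ij by (intro sum.cong) (auto simp: V_def bordered_def)
    also have "\<dots> = (\<Sum>s<n. X $$ (i, s) * (if j = m then y $ s else ref_U M $$ (s, j)))"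
      by (rule truncate[OF ij(1), symmetric])
    \<comment> \<open>The last column is governed by \<open>X y = v\<close>, the others by
      \<open>X U = M\<close>.\<close>
    also have "\<dots> = (if j = m then (X *\<^sub>v y) $ i else (X * ref_U M) $$ (i, j))"
      using ij m X y U by (simp add: scalar_prod_def atLeast0LessThan)
    also have "\<dots> = bordered M v m $$ (i, j)"
      using ij sol ref_lu_correct[OF M nz] by (simp add: bordered_def X_def)
    finally show "bordered M v m $$ (i, j) = (W * V) $$ (i, j)" by simp
  qed (use W V in \<open>simp_all add: bordered_def\<close>)
  then have "det (bordered M v m) = det W * det V" using det_mult[OF W V] by simp
  also have "det W = (\<Prod>i<Suc m. W $$ (i, i))"
  proof -
    have "det W = prod_list (diag_mat W)"
      by (rule det_lower_triangular[OF _ W]) (use m in \<open>auto simp: W_def X_index\<close>)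
    then show ?thesis
      using W by (simp add: prod_list_diag_prod atLeast0LessThan del: prod.lessThan_Suc)
  qed
  \<comment> \<open>The diagonal entry \<open>ipge M i i i\<close> of \<open>ref_L M\<close> is
    \<open>pivot M (Suc i)\<close> and cancels one of the two pivots in the denominator.\<close>
  also have "\<dots> = (\<Prod>i<Suc m. 1 / pivot M i)"
  proof (rule prod.cong)
    fix i assume "i \<in> {..<Suc m}"
    then show "W $$ (i, i) = 1 / pivot M i" using m piv[of "Suc i"] by (simp add: W_def X_index)
  qed simp
  \<comment> \<open>Since \<open>pivot M 0 = 1\<close>, the index can be shifted; the remaining
    pivots are exactly the first \<open>m\<close> diagonal entries of \<open>V\<close>.\<close>
  also have "\<dots> = 1 / (\<Prod>i<m. pivot M (Suc i))"
    by (simp add: prod.lessThan_Suc_shift prod_dividef del: prod.lessThan_Suc pivot.simps(2))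
  also have "det V = (\<Prod>i<Suc m. V $$ (i, i))"
  proof -
    have "det V = prod_list (diag_mat V)"
      by (rule det_upper_triangular[OF _ V])
        (use m M in \<open>auto simp: V_def bordered_def ref_U_def upper_triangular_def\<close>)
    then show ?thesis
      using V by (simp add: prod_list_diag_prod atLeast0LessThan del: prod.lessThan_Suc)
  qed
  also have "\<dots> = (\<Prod>i<m. pivot M (Suc i)) * y $ m"
    using m M by (simp add: V_def bordered_def ref_U_def)
  also have "1 / (\<Prod>i<m. pivot M (Suc i)) * ((\<Prod>i<m. pivot M (Suc i)) * y $ m) = y $ m"
    using m piv by (simp add: prod_zero_iff del: pivot.simps)
  finally show ?thesis by simp
qed

theorem theorem3:
  fixes n :: nat
    and A A' L D U L' D' U' :: "real mat"
    and v w :: "real vec"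
  assumes "A \<in> carrier_mat n n"
    and "v \<in> carrier_vec n"
    and "w \<in> carrier_vec n"
    and "A' = A + outer_prod v w"
    and "\<forall>k\<in>{1..n}. leading_minor A k \<noteq> 0"
    and "\<forall>k\<in>{1..n}. leading_minor A' k \<noteq> 0"
    and "ref_lu A = (L, D, U)"
    and "ref_lu A' = (L', D', U')"
  shows "forward_subst L D v = forward_subst L' D' v \<and>
    mat_inv (L * mat_inv D) *\<^sub>v v = mat_inv (L' * mat_inv D') *\<^sub>v v"
proof -
  note A = assms(1) and v = assms(2) and w = assms(3) and nz = assms(5) and nz' = assms(6)
  have A': "A' \<in> carrier_mat n n"
    using A v w by (simp add: assms(4) outer_prod_def)
  have LD: "L = ref_L A" "D = ref_D A" "L' = ref_L A'" "D' = ref_D A'"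
    using assms(7,8) by (simp_all add: ref_lu_def)
  obtain y where y: "y \<in> carrier_vec n" "(L * mat_inv D) *\<^sub>v y = v"
    using forward_subst_eq(1)[OF A nz v] by (auto simp: LD)
  obtain y' where y': "y' \<in> carrier_vec n" "(L' * mat_inv D') *\<^sub>v y' = v"
    using forward_subst_eq(1)[OF A' nz' v] by (auto simp: LD)
  \<comment> \<open>Both solutions have the same determinant formula entry by entry, as the bordered
    minors of \<open>A\<close> and \<open>A'\<close> agree.\<close>
  have "y = y'"
  proof (rule eq_vecI)
    fix m assume "m < dim_vec y'"
    then have m: "m < n" using y' by simp
    have "y $ m = det (bordered A v m)"
      using solution_eq_det_bordered[OF A nz _ _ m] y by (simp add: LD)
    also have "\<dots> = det (bordered A' v m)"
      using det_bordered_add_outer_prod[OF A v w m] by (simp add: assms(4))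
    also have "\<dots> = y' $ m"
      using solution_eq_det_bordered[OF A' nz' _ _ m] y' by (simp add: LD)
    finally show "y $ m = y' $ m" .
  qed (use y y' in simp)
  moreover have "forward_subst L D v = y"
    using y forward_subst_eq(1)[OF A nz v] A
    by (auto simp: forward_subst_def LD ref_L_def intro!: the1_equality)
  moreover have "forward_subst L' D' v = y'"
    using y' forward_subst_eq(1)[OF A' nz' v] A'
    by (auto simp: forward_subst_def LD ref_L_def intro!: the1_equality)
  \<comment> \<open>The statement with explicit inverses follows because
    \<open>forward_subst\<close> is multiplication by
    \<open>mat_inv (L * mat_inv D)\<close>.\<close>
  ultimately show ?thesis
    using forward_subst_eq(2)[OF A nz v] forward_subst_eq(2)[OF A' nz' v] by (simp add: LD)
qed

end
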